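(* Let $\Gamma\subseteq\mathrm{Sent}(\mathscr{L}_\varepsilon)$ be a complete and consistent set of sentences of an epsilon language $\mathscr{L}_\varepsilon$, and let $\mathfrak{M}$ be the structure with universe $M=\mathrm{Eps}_1/\!=_\Gamma$ described in the context. For $\varphi\in\mathrm{Fm}_{v_i}(\mathscr{L}_\varepsilon)$ put $\varphi(v_i)^{\Gamma}=\{[t]_\Gamma\in M\mid \Gamma\vdash\varphi[t/v_i]\}$. (a) For all variables $v_i$ and all $\varphi,\psi\in\mathrm{Fm}_{v_i}(\mathscr{L}_\varepsilon)$, if $\varphi(v_i)^{\Gamma}=\psi(v_i)^{\Gamma}$ then $[(\varepsilon v_i)\varphi]_\Gamma=[(\varepsilon v_i)\psi]_\Gamma$. (b) There is a choice function $f$ on $M$ such that for all formulae $\varphi\in\mathrm{Fm}(\mathscr{L}_\varepsilon)$, all terms $t\in\mathrm{Tm}(\mathscr{L}_\varepsilon)$ and every valuation $a=([a_1]_\Gamma,[a_2]_\Gamma,\dots)$ of $\mathfrak{M}$ (with $a_1,a_2,\ldots\in\mathrm{Eps}_1$), $$(\mathfrak{M},f)\models\varphi[a]\quad\text{iff}\quad\Gamma\vdash\varphi[a_1/v_1,\dots,a_n/v_n],$$ and $$\Gamma\vdash t^{\mathfrak{M}f}[a]=t[a_1/v_1,\dots,a_n/v_n]$$ (that is, any representative in $\mathrm{Eps}_1$ of the element $t^{\mathfrak{M}f}[a]\in M$ is $\Gamma$-provably equal to $t[a_1/v_1,\dots,a_n/v_n]$), where all the free variables of $\varphi$ and $t$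 are replaced by the corresponding terms. Moreover, $f$ is unique on the set $$\{\,\{[t]_\Gamma\in M\mid \Gamma\vdash\varphi[t/v_i]\}\mid \varphi\in\mathrm{Fm}_{v_i}(\mathscr{L}_\varepsilon)\,\}.$$
   Context: Epsilon language. $\mathsf{t}=(r_i,f_j,c_k)$ is a similarity type of relation, function and constant symbols. $\mathscr{L}_\varepsilon$ is the language with equality freely generated by $\neg,\vee,\varepsilon$ and $\mathsf{t}$: terms and formulae are defined simultaneously; variables, constants and $f_j(t_1,\dots,t_m)$ are terms, and for every formula $\varphi$ and variable $v_i$, $(\varepsilon v_i)\varphi$ is a term, in which $v_i$ is bound. $\varphi[t/v_i]$ denotes substitution. $(\exists v_i)\varphi$ is $\varphi[(\varepsilon v_i)\varphi/v_i]$ and $(\forall v_i)\varphi$ is $\varphi[(\varepsilon v_i)\neg\varphi/v_i]$. $\mathrm{Tm},\mathrm{Fm},\mathrm{Sent}$ denote the sets of terms, formulae and sentences; $\mathrm{Fm}_{v_i}(\mathscr{L}_\varepsilon)$ is the set of formulae with no free variable other than $v_i$. Calculus. $\vdash$ is provability in the extensional epsilon calculus: classical propositional logic with equality together with the axiom of transfinity $\varphi[t/v_i]\rightarrow\varphi[(\varepsilon v_i)\varphi/v_i]$ and the axiom of extensionality $(\forall v_i)(\varphi\leftrightarrow\psi)\rightarrow(\varepsilon v_i)\varphi=(\varepsilon v_i)\psi$. It is known to be complete with respect to choice structures. Choice structures. A choice function on $M$ is a function $f:\mathrm{Sb}(M)\to M$ on the power set of $M$ with $f(S)\in S$ for every nonempty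 $S\subseteq M$ ($f(\emptyset)\in M$ is arbitrary). A choice structure ($\mathscr{L}_\varepsilon$-model) is a pair $(\mathfrak{M},f)$ with $\mathfrak{M}$ a first-order $\mathsf{t}$-structure on $M$ and $f$ a choice function on $M$. Terms and formulae are evaluated as usual, with $((\varepsilon v_i)\varphi)^{\mathfrak{M}f}[a]=f(\{m\in M\mid(\mathfrak{M},f)\models\varphi[a(v_i\mapsto m)]\})$. The structure $\mathfrak{M}$. $\mathrm{Eps}_1=\{(\varepsilon v_i)\varphi\mid v_i \text{ a variable},\ \varphi\in\mathrm{Fm}_{v_i}(\mathscr{L}_\varepsilon)\}$; $t_1=_\Gamma t_2$ iff $\Gamma\vdash t_1=t_2$; $[t]_\Gamma$ is the class of $t$; $M=\mathrm{Eps}_1/\!=_\Gamma$. The interpretations are: $([a_1]_\Gamma,\dots,[a_l]_\Gamma)\in r_i^{\mathfrak{M}}$ iff $\Gamma\vdash r_i(a_1,\dots,a_l)$; $f_j^{\mathfrak{M}}([a_1]_\Gamma,\dots,[a_m]_\Gamma)=[(\varepsilon v_0)(v_0=f_j(a_1,\dots,a_m))]_\Gamma$; $c_k^{\mathfrak{M}}=[(\varepsilon v_0)(v_0=c_k)]_\Gamma$. *)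

theory Defs
  imports Main
begin

section \<open>Syntax of the epsilon language\<close>

text \<open>A similarity type selects its symbols from the types \<open>'r\<close>, \<open>'f\<close>, \<open>'c\<close>; each of the three
  symbol sets may be empty or infinite.\<close>

record ('r, 'f, 'c) sim_type =
  rels :: "'r set"
  funs :: "'f set"
  csts :: "'c set"
  rel_ar :: "'r \<Rightarrow> nat"
  fun_ar :: "'f \<Rightarrow> nat"

text \<open>The variable \<open>v\<^sub>i\<close> is represented by the index \<open>i\<close>.\<close>

datatype ('r, 'f, 'c) tm =
    Var nat
  | Cst 'c
  | Fn 'f "('r, 'f, 'c) tm list"
  | Epsilon nat "('r, 'f, 'c) fm"
and ('r, 'f, 'c) fm =
    Rel 'r "('r, 'f, 'c) tm list"
  | Eq "('r, 'f, 'c) tm" "('r, 'f, 'c) tm"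
  | Neg "('r, 'f, 'c) fm"
  | Or "('r, 'f, 'c) fm" "('r, 'f, 'c) fm"

fun wf_tm :: "('r, 'f, 'c) sim_type \<Rightarrow> ('r, 'f, 'c) tm \<Rightarrow> bool"
  and wf_fm :: "('r, 'f, 'c) sim_type \<Rightarrow> ('r, 'f, 'c) fm \<Rightarrow> bool" where
  "wf_tm L (Var i) \<longleftrightarrow> True"
| "wf_tm L (Cst c) \<longleftrightarrow> c \<in> csts L"
| "wf_tm L (Fn g ts) \<longleftrightarrow> g \<in> funs L \<and> length ts = fun_ar L g \<and> (\<forall>t\<in>set ts. wf_tm L t)"
| "wf_tm L (Epsilon i \<phi>) \<longleftrightarrow> wf_fm L \<phi>"
| "wf_fm L (Rel r ts) \<longleftrightarrow> r \<in> rels L \<and> length ts = rel_ar L r \<and> (\<forall>t\<in>set ts. wf_tm L t)"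
| "wf_fm L (Eq s t) \<longleftrightarrow> wf_tm L s \<and> wf_tm L t"
| "wf_fm L (Neg \<phi>) \<longleftrightarrow> wf_fm L \<phi>"
| "wf_fm L (Or \<phi> \<psi>) \<longleftrightarrow> wf_fm L \<phi> \<and> wf_fm L \<psi>"

fun fv_tm :: "('r, 'f, 'c) tm \<Rightarrow> nat set"
  and fv_fm :: "('r, 'f, 'c) fm \<Rightarrow> nat set" where
  "fv_tm (Var i) = {i}"
| "fv_tm (Cst c) = {}"
| "fv_tm (Fn g ts) = (\<Union>t\<in>set ts. fv_tm t)"
| "fv_tm (Epsilon i \<phi>) = fv_fm \<phi> - {i}"
| "fv_fm (Rel r ts) = (\<Union>t\<in>set ts. fv_tm t)"
| "fv_fm (Eq s t) = fv_tm s \<union> fv_tm t"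
| "fv_fm (Neg \<phi>) = fv_fm \<phi>"
| "fv_fm (Or \<phi> \<psi>) = fv_fm \<phi> \<union> fv_fm \<psi>"

definition Tm :: "('r, 'f, 'c) sim_type \<Rightarrow> ('r, 'f, 'c) tm set" where
  "Tm L = {t. wf_tm L t}"

definition Fm :: "('r, 'f, 'c) sim_type \<Rightarrow> ('r, 'f, 'c) fm set" where
  "Fm L = {\<phi>. wf_fm L \<phi>}"

definition Sent :: "('r, 'f, 'c) sim_type \<Rightarrow> ('r, 'f, 'c) fm set" where
  "Sent L = {\<phi> \<in> Fm L. fv_fm \<phi> = {}}"

definition Fm1 :: "('r, 'f, 'c) sim_type \<Rightarrow> nat \<Rightarrow> ('r, 'f, 'c) fm set" where
  "Fm1 L i = {\<phi> \<in> Fm L. fv_fm \<phi> \<subseteq> {i}}"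

definition Eps1 :: "('r, 'f, 'c) sim_type \<Rightarrow> ('r, 'f, 'c) tm set" where
  "Eps1 L = {Epsilon i \<phi> | i \<phi>. \<phi> \<in> Fm1 L i}"

text \<open>Substitution is simultaneous and capture-avoiding: the variable bound by an epsilon term is
  renamed, to the least available variable, precisely when it occurs free in a term substituted for
  a free variable of that epsilon term.  In particular no renaming takes place when the substituted
  terms are closed.\<close>

definition bound_var :: "nat \<Rightarrow> nat set \<Rightarrow> nat" where
  "bound_var i V = (if i \<in> V then LEAST j. j \<notin> V else i)"

fun subst_tm :: "(nat \<Rightarrow> ('r, 'f, 'c) tm) \<Rightarrow> ('r, 'f, 'c) tm \<Rightarrow> ('r, 'f, 'c) tm"
  and subst_fm :: "(nat \<Rightarrow> ('r, 'f, 'c) tm) \<Rightarrow> ('r, 'f, 'c) fm \<Rightarrow> ('r, 'f, 'c) fm" where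
  "subst_tm \<sigma> (Var i) = \<sigma> i"
| "subst_tm \<sigma> (Cst c) = Cst c"
| "subst_tm \<sigma> (Fn g ts) = Fn g (map (\<lambda>t. subst_tm \<sigma> t) ts)"
| "subst_tm \<sigma> (Epsilon i \<phi>) =
     (let k = bound_var i (\<Union>j\<in>fv_fm \<phi> - {i}. fv_tm (\<sigma> j))
      in Epsilon k (subst_fm (\<sigma>(i := Var k)) \<phi>))"
| "subst_fm \<sigma> (Rel r ts) = Rel r (map (\<lambda>t. subst_tm \<sigma> t) ts)"
| "subst_fm \<sigma> (Eq s t) = Eq (subst_tm \<sigma> s) (subst_tm \<sigma> t)"
| "subst_fm \<sigma> (Neg \<phi>) = Neg (subst_fm \<sigma> \<phi>)"
| "subst_fm \<sigma> (Or \<phi> \<psi>) = Or (subst_fm \<sigma> \<phi>) (subst_fm \<sigma> \<psi>)"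

text \<open>\<open>subst1 \<phi> t i\<close> is \<open>\<phi>[t/v\<^sub>i]\<close>.\<close>

definition subst1 :: "('r, 'f, 'c) fm \<Rightarrow> ('r, 'f, 'c) tm \<Rightarrow> nat \<Rightarrow> ('r, 'f, 'c) fm" where
  "subst1 \<phi> t i = subst_fm (Var(i := t)) \<phi>"

lemma subst_cong:
  fixes t :: "('r, 'f, 'c) tm" and \<phi> :: "('r, 'f, 'c) fm"
  shows "(\<And>i. i \<in> fv_tm t \<Longrightarrow> \<sigma> i = \<tau> i) \<Longrightarrow> subst_tm \<sigma> t = subst_tm \<tau> t"
    and "(\<And>i. i \<in> fv_fm \<phi> \<Longrightarrow> \<sigma> i = \<tau> i) \<Longrightarrow> subst_fm \<sigma> \<phi> = subst_fm \<tau> \<phi>"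
proof (induction t and \<phi> arbitrary: \<sigma> \<tau> and \<sigma> \<tau> rule: fv_tm_fv_fm.induct)
  case (3 g ts)
  have "subst_tm \<sigma> t = subst_tm \<tau> t" if "t \<in> set ts" for t
    by (rule 3(1)[OF that]) (use 3(2) that in auto)
  then show ?case by simp
next
  case (4 i \<phi>)
  have "(\<Union>j\<in>fv_fm \<phi> - {i}. fv_tm (\<sigma> j)) = (\<Union>j\<in>fv_fm \<phi> - {i}. fv_tm (\<tau> j))"
    using 4(2) by simp
  moreover have "subst_fm (\<sigma>(i := Var k)) \<phi> = subst_fm (\<tau>(i := Var k)) \<phi>" for k
    by (rule 4(1)) (use 4(2) in auto)
  ultimately show ?case by simp
next
  case (5 r ts)
  have "subst_tm \<sigma> t = subst_tm \<tau> t" if "t \<in> set ts" for t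
    by (rule 5(1)[OF that]) (use 5(2) that in auto)
  then show ?case by simp
next
  case (6 s t)
  have "subst_tm \<sigma> s = subst_tm \<tau> s" by (rule 6(1)) (use 6(3) in auto)
  moreover have "subst_tm \<sigma> t = subst_tm \<tau> t" by (rule 6(2)) (use 6(3) in auto)
  ultimately show ?case by simp
next
  case (7 \<phi>)
  have "subst_fm \<sigma> \<phi> = subst_fm \<tau> \<phi>" by (rule 7(1)) (use 7(2) in auto)
  then show ?case by simp
next
  case (8 \<phi> \<psi>)
  have "subst_fm \<sigma> \<phi> = subst_fm \<tau> \<phi>" by (rule 8(1)) (use 8(3) in auto)
  moreover have "subst_fm \<sigma> \<psi> = subst_fm \<tau> \<psi>" by (rule 8(2)) (use 8(3) in auto)
  ultimately show ?case by simp
qed auto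

lemma subst_Var:
  fixes t :: "('r, 'f, 'c) tm" and \<phi> :: "('r, 'f, 'c) fm"
  shows "subst_tm Var t = t" and "subst_fm Var \<phi> = \<phi>"
proof (induction t and \<phi> rule: fv_tm_fv_fm.induct)
  case (4 i \<phi>)
  have "bound_var i (fv_fm \<phi> - {i}) = i" by (simp add: bound_var_def)
  then show ?case using 4 by (simp add: fun_upd_idem)
qed (auto simp: map_idI)

lemma subst_closed: "fv_tm t = {} \<Longrightarrow> subst_tm \<sigma> t = t"
  using subst_cong(1)[of t \<sigma> Var] by (simp add: subst_Var)

definition Imp :: "('r, 'f, 'c) fm \<Rightarrow> ('r, 'f, 'c) fm \<Rightarrow> ('r, 'f, 'c) fm" where
  "Imp \<phi> \<psi> = Or (Neg \<phi>) \<psi>"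

definition Iff :: "('r, 'f, 'c) fm \<Rightarrow> ('r, 'f, 'c) fm \<Rightarrow> ('r, 'f, 'c) fm" where
  "Iff \<phi> \<psi> = Neg (Or (Neg (Imp \<phi> \<psi>)) (Neg (Imp \<psi> \<phi>)))"

definition Forall :: "nat \<Rightarrow> ('r, 'f, 'c) fm \<Rightarrow> ('r, 'f, 'c) fm" where
  "Forall i \<phi> = subst1 \<phi> (Epsilon i (Neg \<phi>)) i"

section \<open>The extensional epsilon calculus\<close>

text \<open>Propositional tautologies: every formula that is not a negation or a disjunction is treated
  as a propositional atom.\<close>

definition tautology :: "('r, 'f, 'c) fm \<Rightarrow> bool" where
  "tautology \<phi> \<longleftrightarrow>
     (\<forall>v. (\<forall>\<psi>. v (Neg \<psi>) \<longleftrightarrow> \<not> v \<psi>) \<and> (\<forall>\<psi> \<chi>. v (Or \<psi> \<chi>) \<longleftrightarrow> v \<psi> \<or> v \<chi>) \<longrightarrow> v \<phi>)"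

inductive prov :: "('r, 'f, 'c) sim_type \<Rightarrow> ('r, 'f, 'c) fm set \<Rightarrow> ('r, 'f, 'c) fm \<Rightarrow> bool"
  for L :: "('r, 'f, 'c) sim_type" and \<Gamma> :: "('r, 'f, 'c) fm set" where
  hyp: "\<phi> \<in> \<Gamma> \<Longrightarrow> prov L \<Gamma> \<phi>"
| taut: "\<phi> \<in> Fm L \<Longrightarrow> tautology \<phi> \<Longrightarrow> prov L \<Gamma> \<phi>"
| eq_refl: "t \<in> Tm L \<Longrightarrow> prov L \<Gamma> (Eq t t)"
| eq_subst: "s \<in> Tm L \<Longrightarrow> t \<in> Tm L \<Longrightarrow> \<phi> \<in> Fm L \<Longrightarrow>
    prov L \<Gamma> (Imp (Eq s t) (Imp (subst1 \<phi> s i) (subst1 \<phi> t i)))"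
| transfinity: "t \<in> Tm L \<Longrightarrow> \<phi> \<in> Fm L \<Longrightarrow>
    prov L \<Gamma> (Imp (subst1 \<phi> t i) (subst1 \<phi> (Epsilon i \<phi>) i))"
| extensionality: "\<phi> \<in> Fm L \<Longrightarrow> \<psi> \<in> Fm L \<Longrightarrow>
    prov L \<Gamma> (Imp (Forall i (Iff \<phi> \<psi>)) (Eq (Epsilon i \<phi>) (Epsilon i \<psi>)))"
| mp: "prov L \<Gamma> (Imp \<phi> \<psi>) \<Longrightarrow> prov L \<Gamma> \<phi> \<Longrightarrow> prov L \<Gamma> \<psi>"

definition consistent_set :: "('r, 'f, 'c) sim_type \<Rightarrow> ('r, 'f, 'c) fm set \<Rightarrow> bool" where
  "consistent_set L \<Gamma> \<longleftrightarrow> \<not> (\<exists>\<phi>\<in>Fm L. prov L \<Gamma> \<phi> \<and> prov L \<Gamma> (Neg \<phi>))"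

definition complete_set :: "('r, 'f, 'c) sim_type \<Rightarrow> ('r, 'f, 'c) fm set \<Rightarrow> bool" where
  "complete_set L \<Gamma> \<longleftrightarrow> (\<forall>\<phi>\<in>Sent L. prov L \<Gamma> \<phi> \<or> prov L \<Gamma> (Neg \<phi>))"

section \<open>Choice structures\<close>

record ('r, 'f, 'c, 'm) fo_struct =
  univ :: "'m set"
  rel_int :: "'r \<Rightarrow> 'm list set"
  fun_int :: "'f \<Rightarrow> 'm list \<Rightarrow> 'm"
  cst_int :: "'c \<Rightarrow> 'm"

definition choice_function :: "'m set \<Rightarrow> ('m set \<Rightarrow> 'm) \<Rightarrow> bool" where
  "choice_function M f \<longleftrightarrow> (\<forall>S. S \<subseteq> M \<longrightarrow> f S \<in> M \<and> (S \<noteq> {} \<longrightarrow> f S \<in> S))"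

fun eval_tm :: "('r, 'f, 'c, 'm) fo_struct \<Rightarrow> ('m set \<Rightarrow> 'm) \<Rightarrow> (nat \<Rightarrow> 'm) \<Rightarrow>
    ('r, 'f, 'c) tm \<Rightarrow> 'm"
  and sat :: "('r, 'f, 'c, 'm) fo_struct \<Rightarrow> ('m set \<Rightarrow> 'm) \<Rightarrow> (nat \<Rightarrow> 'm) \<Rightarrow>
    ('r, 'f, 'c) fm \<Rightarrow> bool" where
  "eval_tm \<MM> f a (Var i) = a i"
| "eval_tm \<MM> f a (Cst c) = cst_int \<MM> c"
| "eval_tm \<MM> f a (Fn g ts) = fun_int \<MM> g (map (\<lambda>t. eval_tm \<MM> f a t) ts)"
| "eval_tm \<MM> f a (Epsilon i \<phi>) = f {m \<in> univ \<MM>. sat \<MM> f (a(i := m)) \<phi>}"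
| "sat \<MM> f a (Rel r ts) \<longleftrightarrow> map (\<lambda>t. eval_tm \<MM> f a t) ts \<in> rel_int \<MM> r"
| "sat \<MM> f a (Eq s t) \<longleftrightarrow> eval_tm \<MM> f a s = eval_tm \<MM> f a t"
| "sat \<MM> f a (Neg \<phi>) \<longleftrightarrow> \<not> sat \<MM> f a \<phi>"
| "sat \<MM> f a (Or \<phi> \<psi>) \<longleftrightarrow> sat \<MM> f a \<phi> \<or> sat \<MM> f a \<psi>"

section \<open>The structure built from a set of sentences\<close>

definition prov_eq :: "('r, 'f, 'c) sim_type \<Rightarrow> ('r, 'f, 'c) fm set \<Rightarrow>
    (('r, 'f, 'c) tm \<times> ('r, 'f, 'c) tm) set" where
  "prov_eq L \<Gamma> = {(s, t). s \<in> Eps1 L \<and> t \<in> Eps1 L \<and> prov L \<Gamma> (Eq s t)}"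

definition cls :: "('r, 'f, 'c) sim_type \<Rightarrow> ('r, 'f, 'c) fm set \<Rightarrow> ('r, 'f, 'c) tm \<Rightarrow>
    ('r, 'f, 'c) tm set" where
  "cls L \<Gamma> t = prov_eq L \<Gamma> `` {t}"

text \<open>The value of a function symbol is the element determined by any choice of representatives;
  see \<open>term_struct_fun\<close> below.\<close>

definition term_struct :: "('r, 'f, 'c) sim_type \<Rightarrow> ('r, 'f, 'c) fm set \<Rightarrow>
    ('r, 'f, 'c, ('r, 'f, 'c) tm set) fo_struct" where
  "term_struct L \<Gamma> =
     \<lparr> univ = Eps1 L // prov_eq L \<Gamma>,
       rel_int = (\<lambda>r. {map (cls L \<Gamma>) as | as. as \<in> lists (Eps1 L) \<and> prov L \<Gamma> (Rel r as)}),
       fun_int = (\<lambda>g xs. THE y. \<exists>as\<in>lists (Eps1 L).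
          map (cls L \<Gamma>) as = xs \<and> y = cls L \<Gamma> (Epsilon 0 (Eq (Var 0) (Fn g as)))),
       cst_int = (\<lambda>c. cls L \<Gamma> (Epsilon 0 (Eq (Var 0) (Cst c)))) \<rparr>"

text \<open>The interpretations do not depend on the representatives.\<close>

lemma Eps1_closed: "t \<in> Eps1 L \<Longrightarrow> t \<in> Tm L \<and> fv_tm t = {}"
  by (auto simp: Eps1_def Fm1_def Tm_def Fm_def)

lemma prov_rewrite:
  assumes "s \<in> Tm L" "t \<in> Tm L" "\<phi> \<in> Fm L" "prov L \<Gamma> (Eq s t)" "prov L \<Gamma> (subst1 \<phi> s i)"
  shows "prov L \<Gamma> (subst1 \<phi> t i)"
  using assms eq_subst mp by meson

lemma prov_eq_sym:
  assumes "s \<in> Eps1 L" "t \<in> Eps1 L" "prov L \<Gamma> (Eq s t)"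
  shows "prov L \<Gamma> (Eq t s)"
proof -
  note cl = Eps1_closed[OF assms(1)] Eps1_closed[OF assms(2)]
  have "prov L \<Gamma> (subst1 (Eq (Var 0) s) t 0)"
    by (rule prov_rewrite[OF _ _ _ assms(3)])
       (use cl in \<open>auto simp: subst1_def subst_closed Fm_def Tm_def intro: eq_refl\<close>)
  then show ?thesis using cl by (simp add: subst1_def subst_closed)
qed

lemma prov_eq_trans:
  assumes "s \<in> Eps1 L" "t \<in> Eps1 L" "u \<in> Eps1 L" "prov L \<Gamma> (Eq s t)" "prov L \<Gamma> (Eq t u)"
  shows "prov L \<Gamma> (Eq s u)"
proof -
  note cl = Eps1_closed[OF assms(1)] Eps1_closed[OF assms(2)] Eps1_closed[OF assms(3)]
  have "prov L \<Gamma> (subst1 (Eq s (Var 0)) u 0)"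
    by (rule prov_rewrite[OF _ _ _ assms(5)])
       (use cl assms(4) in \<open>auto simp: subst1_def subst_closed Fm_def Tm_def\<close>)
  then show ?thesis using cl by (simp add: subst1_def subst_closed)
qed

lemma equiv_prov_eq: "equiv (Eps1 L) (prov_eq L \<Gamma>)"
  unfolding equiv_def refl_on_def sym_def trans_def prov_eq_def
  using prov_eq_sym prov_eq_trans Eps1_closed eq_refl by blast

lemma cls_eq_iff:
  "s \<in> Eps1 L \<Longrightarrow> t \<in> Eps1 L \<Longrightarrow> cls L \<Gamma> s = cls L \<Gamma> t \<longleftrightarrow> prov L \<Gamma> (Eq s t)"
  unfolding cls_def eq_equiv_class_iff[OF equiv_prov_eq] by (simp add: prov_eq_def)

lemma prov_replace_args:
  assumes wf: "\<And>ts. length ts = length as \<Longrightarrow> set ts \<subseteq> Tm L \<Longrightarrow> F ts \<in> Fm L"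
    and sb: "\<And>ts t. subst1 (F ts) t 1 = F (map (subst_tm (Var(1 := t))) ts) \<or> t \<notin> Eps1 L"
    and "as \<in> lists (Eps1 L)" "bs \<in> lists (Eps1 L)"
    and "map (cls L \<Gamma>) as = map (cls L \<Gamma>) bs" "prov L \<Gamma> (F as)"
  shows "prov L \<Gamma> (F bs)"
proof -
  have len: "length as = length bs" using assms(5) by (rule map_eq_imp_length_eq)
  have a: "as ! i \<in> Eps1 L" if "i < length as" for i
    using assms(3) that by auto
  have b: "bs ! i \<in> Eps1 L" if "i < length as" for i
    using assms(4) that len by auto
  have eq: "prov L \<Gamma> (Eq (as ! i) (bs ! i))" if "i < length as" for i
  proof -
    have "cls L \<Gamma> (as ! i) = cls L \<Gamma> (bs ! i)"
      using arg_cong[OF assms(5), of "\<lambda>xs. xs ! i"] that len by simp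
    then show ?thesis using cls_eq_iff[OF a b, OF that that] by simp
  qed
  have "n \<le> length as \<Longrightarrow> prov L \<Gamma> (F (take n bs @ drop n as))" for n
  proof (induction n)
    case 0
    then show ?case using assms(6) by simp
  next
    case (Suc n)
    then have n: "n < length as" by simp
    define ts where "ts = take n bs @ Var 1 # drop (Suc n) as"
    have inA: "set (take n bs) \<subseteq> Eps1 L" "set (drop (Suc n) as) \<subseteq> Eps1 L"
      using assms(3,4) set_take_subset[of n bs] set_drop_subset[of "Suc n" as] by auto
    have cl: "map (subst_tm (Var(1 := t))) xs = xs" if "set xs \<subseteq> Eps1 L" for xs t
      using that Eps1_closed subst_closed by (metis (no_types, lifting) map_idI subsetD)
    have F: "subst1 (F ts) t 1 = F (take n bs @ t # drop (Suc n) as)" if "t \<in> Eps1 L" for t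
      using sb[of ts t] that cl[OF inA(1)] cl[OF inA(2)] by (simp add: ts_def)
    have "F ts \<in> Fm L"
      by (rule wf) (use inA n len Eps1_closed in \<open>auto simp: ts_def Tm_def\<close>)
    moreover have "prov L \<Gamma> (subst1 (F ts) (as ! n) 1)"
      using Suc n by (simp only: F[OF a[OF n]] Cons_nth_drop_Suc[OF n])
    ultimately have "prov L \<Gamma> (subst1 (F ts) (bs ! n) 1)"
      using prov_rewrite[OF _ _ _ eq[OF n]] Eps1_closed a[OF n] b[OF n] by blast
    then show ?case
      using n len by (simp only: F[OF b[OF n]]) (simp add: take_Suc_conv_app_nth)
  qed
  from this[of "length as"] show ?thesis using len by simp
qed

lemma term_struct_rel:
  assumes "r \<in> rels L" "as \<in> lists (Eps1 L)" "length as = rel_ar L r"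
  shows "map (cls L \<Gamma>) as \<in> rel_int (term_struct L \<Gamma>) r \<longleftrightarrow> prov L \<Gamma> (Rel r as)"
proof
  assume "map (cls L \<Gamma>) as \<in> rel_int (term_struct L \<Gamma>) r"
  then obtain bs where bs: "map (cls L \<Gamma>) bs = map (cls L \<Gamma>) as" "bs \<in> lists (Eps1 L)"
      "prov L \<Gamma> (Rel r bs)"
    unfolding term_struct_def fo_struct.simps mem_Collect_eq by metis
  have "length bs = rel_ar L r" using map_eq_imp_length_eq[OF bs(1)] assms(3) by simp
  then show "prov L \<Gamma> (Rel r as)"
    using prov_replace_args[of bs L "Rel r", OF _ _ bs(2) assms(2) bs(1,3)] assms(1)
    by (auto simp: Fm_def Tm_def subst1_def)
next
  assume "prov L \<Gamma> (Rel r as)"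
  then show "map (cls L \<Gamma>) as \<in> rel_int (term_struct L \<Gamma>) r"
    using assms(2) by (auto simp: term_struct_def)
qed

lemma term_struct_fun:
  fixes L :: "('r, 'f, 'c) sim_type"
  assumes "g \<in> funs L" "as \<in> lists (Eps1 L)" "length as = fun_ar L g"
  shows "fun_int (term_struct L \<Gamma>) g (map (cls L \<Gamma>) as) =
    cls L \<Gamma> (Epsilon 0 (Eq (Var 0) (Fn g as)))"
proof -
  let ?e = "\<lambda>as :: ('r, 'f, 'c) tm list. Epsilon 0 (Eq (Var 0) (Fn g as)) :: ('r, 'f, 'c) tm"
  have e: "?e bs \<in> Eps1 L" if "bs \<in> lists (Eps1 L)" "length bs = fun_ar L g" for bs
  proof -
    have "Eq (Var 0) (Fn g bs) \<in> Fm1 L 0"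
      using that assms(1) Eps1_closed by (fastforce simp: Fm1_def Fm_def Tm_def)
    then show ?thesis by (auto simp: Eps1_def)
  qed
  have "cls L \<Gamma> (?e bs) = cls L \<Gamma> (?e as)"
    if bs: "bs \<in> lists (Eps1 L)" "map (cls L \<Gamma>) bs = map (cls L \<Gamma>) as" for bs
  proof -
    have len: "length bs = fun_ar L g" using map_eq_imp_length_eq[OF bs(2)] assms(3) by simp
    have ecl: "fv_tm (?e as) = {}" "?e as \<in> Tm L"
      using Eps1_closed[OF e[OF assms(2,3)]] by auto
    have sb: "subst1 (Eq (?e as) (?e ts)) t 1 =
        Eq (?e as) (?e (map (subst_tm (Var(1 := t))) ts))" if "t \<in> Eps1 L" for ts t
    proof -
      let ?V = "\<Union>j\<in>fv_fm (Eq (Var 0) (Fn g ts)) - {0}. fv_tm ((Var(1 := t)) j)"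
      have "fv_tm t = {}" using Eps1_closed[OF that] by blast
      then have "0 \<notin> ?V" by (auto split: if_splits)
      then have "bound_var 0 ?V = 0" by (simp add: bound_var_def)
      moreover have "(Var(1 := t))(0 := Var 0) = Var(1 := t)" by auto
      ultimately have "subst_tm (Var(1 := t)) (?e ts) = ?e (map (subst_tm (Var(1 := t))) ts)"
        by (simp only: subst_tm.simps(4) Let_def) simp
      then show ?thesis
        by (simp only: subst1_def subst_fm.simps(2) subst_closed[OF ecl(1)])
    qed
    have wf: "Eq (?e as) (?e ts) \<in> Fm L" if "length ts = length as" "set ts \<subseteq> Tm L" for ts
      using that ecl(2) assms(1,3) by (auto simp: Fm_def Tm_def)
    have "prov L \<Gamma> (Eq (?e as) (?e bs))"
      using prov_replace_args[of as L "\<lambda>ts. Eq (?e as) (?e ts)" bs,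
          OF wf _ assms(2) bs(1) bs(2)[symmetric] eq_refl[OF ecl(2)]] sb by blast
    then show ?thesis
      using cls_eq_iff[OF e[OF assms(2,3)] e[OF bs(1) len], of \<Gamma>] by metis
  qed
  then show ?thesis
    unfolding term_struct_def fo_struct.simps
    by (intro the_equality bexI[OF _ assms(2)]) blast+
qed

text \<open>\<open>def_set L \<Gamma> i \<phi>\<close> is \<open>\<phi>(v\<^sub>i)\<^sup>\<Gamma>\<close>.\<close>

definition def_set :: "('r, 'f, 'c) sim_type \<Rightarrow> ('r, 'f, 'c) fm set \<Rightarrow> nat \<Rightarrow>
    ('r, 'f, 'c) fm \<Rightarrow> ('r, 'f, 'c) tm set set" where
  "def_set L \<Gamma> i \<phi> = {cls L \<Gamma> t | t. t \<in> Eps1 L \<and> prov L \<Gamma> (subst1 \<phi> t i)}"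

definition truth_choice :: "('r, 'f, 'c) sim_type \<Rightarrow> ('r, 'f, 'c) fm set \<Rightarrow>
    (('r, 'f, 'c) tm set set \<Rightarrow> ('r, 'f, 'c) tm set) \<Rightarrow> bool" where
  "truth_choice L \<Gamma> f \<longleftrightarrow>
     choice_function (univ (term_struct L \<Gamma>)) f \<and>
     (\<forall>a. (\<forall>n. a n \<in> Eps1 L) \<longrightarrow>
       (\<forall>\<phi>\<in>Fm L. sat (term_struct L \<Gamma>) f (\<lambda>n. cls L \<Gamma> (a n)) \<phi> \<longleftrightarrow> prov L \<Gamma> (subst_fm a \<phi>)) \<and>
       (\<forall>t\<in>Tm L. eval_tm (term_struct L \<Gamma>) f (\<lambda>n. cls L \<Gamma> (a n)) t \<in> univ (term_struct L \<Gamma>) \<and>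
          (\<forall>s\<in>eval_tm (term_struct L \<Gamma>) f (\<lambda>n. cls L \<Gamma> (a n)) t.
             prov L \<Gamma> (Eq s (subst_tm a t)))))"

end

theory Submission
  imports Defs
begin

text \<open>The choice function sends each definable set \<open>\<phi>(v\<^sub>i)\<^sup>\<Gamma>\<close> to the class of \<open>(\<epsilon>v\<^sub>i)\<phi>\<close>, and any other
  set to an arbitrary element, taken from the set when it is nonempty.  It is a choice function by
  the axiom of transfinity (\<open>Epsilon_in_def_set\<close>).  The truth condition then follows by a
  simultaneous induction on terms and formulae (\<open>truth_lemma\<close>): completeness and consistency carry
  the connectives, and in the case of \<open>(\<epsilon>v\<^sub>i)\<phi>\<close> the induction hypothesis identifies the set of
  satisfying elements with the set defined by the formula that arises from \<open>\<phi>\<close> by instantiating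
  all variables except \<open>v\<^sub>i\<close>.  Conversely, the truth condition for \<open>\<phi>\<close> and \<open>(\<epsilon>v\<^sub>i)\<phi>\<close> forces the
  value at \<open>\<phi>(v\<^sub>i)\<^sup>\<Gamma>\<close>, which gives uniqueness.

  What has to be shown is that the function is well defined: formulae that define the same set must
  have provably equal epsilon terms.  Suppose first that both have the same variable \<open>v\<^sub>i\<close>.  By
  extensionality it suffices to prove \<open>(\<forall>v\<^sub>i)(\<phi> \<leftrightarrow> \<psi>)\<close>, which is the instance of \<open>\<phi> \<leftrightarrow> \<psi>\<close> at one
  closed epsilon term; as \<open>\<Gamma>\<close> decides both sides, it follows from the equality of the two sets
  (\<open>def_set_eq_imp_Epsilon_eq\<close>).

  For different variables one needs, for \<open>\<phi>\<close> without free variables other than \<open>v\<^sub>i\<close>, that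
  \<open>(\<epsilon>v\<^sub>i)\<phi> = (\<epsilon>v\<^sub>k)\<phi>[v\<^sub>k/v\<^sub>i]\<close> for some fresh \<open>v\<^sub>k\<close>.  There is no axiom for a change of bound
  variables, but the calculus derives it (\<open>prov_alpha\<close>): transfinity also admits open terms, and
  substituting an open term into an epsilon term renames the bound variable when it would
  capture a variable of the substituted term.\<close>

section \<open>Substitution\<close>

lemma finite_fv:
  fixes t :: "('r, 'f, 'c) tm" and \<phi> :: "('r, 'f, 'c) fm"
  shows "finite (fv_tm t)" and "finite (fv_fm \<phi>)"
  by (induction t and \<phi> rule: fv_tm_fv_fm.induct) auto

lemma wf_subst:
  fixes t :: "('r, 'f, 'c) tm" and \<phi> :: "('r, 'f, 'c) fm"
  shows "wf_tm L t \<Longrightarrow> (\<And>j. wf_tm L (\<sigma> j)) \<Longrightarrow> wf_tm L (subst_tm \<sigma> t)"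
    and "wf_fm L \<phi> \<Longrightarrow> (\<And>j. wf_tm L (\<sigma> j)) \<Longrightarrow> wf_fm L (subst_fm \<sigma> \<phi>)"
  by (induction t and \<phi> arbitrary: \<sigma> and \<sigma> rule: fv_tm_fv_fm.induct) (auto simp: Let_def)

lemma fv_subst:
  fixes t :: "('r, 'f, 'c) tm" and \<phi> :: "('r, 'f, 'c) fm"
  shows "fv_tm (subst_tm \<sigma> t) \<subseteq> (\<Union>j\<in>fv_tm t. fv_tm (\<sigma> j))"
    and "fv_fm (subst_fm \<sigma> \<phi>) \<subseteq> (\<Union>j\<in>fv_fm \<phi>. fv_tm (\<sigma> j))"
proof (induction t and \<phi> arbitrary: \<sigma> and \<sigma> rule: fv_tm_fv_fm.induct)
  case (4 i \<phi>)
  define k where "k = bound_var i (\<Union>j\<in>fv_fm \<phi> - {i}. fv_tm (\<sigma> j))"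
  have "fv_fm (subst_fm (\<sigma>(i := Var k)) \<phi>) \<subseteq> (\<Union>j\<in>fv_fm \<phi>. fv_tm ((\<sigma>(i := Var k)) j))"
    by (rule 4)
  then show ?case by (auto simp: Let_def k_def[symmetric] split: if_splits)
qed fastforce+

lemma subst1_Fm: "\<phi> \<in> Fm L \<Longrightarrow> t \<in> Tm L \<Longrightarrow> subst1 \<phi> t i \<in> Fm L"
  by (auto simp: subst1_def Fm_def Tm_def intro!: wf_subst)

lemma fv_subst1: "fv_fm (subst1 \<phi> t i) \<subseteq> (fv_fm \<phi> - {i}) \<union> fv_tm t"
  using fv_subst(2)[of "Var(i := t)" \<phi>] by (fastforce simp: subst1_def split: if_splits)

lemma subst1_Sent: "\<phi> \<in> Fm1 L i \<Longrightarrow> t \<in> Eps1 L \<Longrightarrow> subst1 \<phi> t i \<in> Sent L"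
  using fv_subst1[of \<phi> t i] Eps1_closed[of t L] subst1_Fm[of \<phi> L t i]
  by (auto simp: Sent_def Fm1_def)

lemma subst1_simps [simp]:
  "subst1 (Neg \<phi>) t i = Neg (subst1 \<phi> t i)"
  "subst1 (Or \<phi> \<psi>) t i = Or (subst1 \<phi> t i) (subst1 \<psi> t i)"
  "subst1 (Imp \<phi> \<psi>) t i = Imp (subst1 \<phi> t i) (subst1 \<psi> t i)"
  "subst1 (Iff \<phi> \<psi>) t i = Iff (subst1 \<phi> t i) (subst1 \<psi> t i)"
  by (simp_all add: subst1_def Imp_def Iff_def)

lemma subst_tm_not_free:
  assumes "w \<notin> fv_tm s"
  shows "subst_tm (Var(w := u)) s = s"
proof -
  have "subst_tm (Var(w := u)) s = subst_tm Var s"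
    by (rule subst_cong(1)) (use assms in auto)
  then show ?thesis by (simp add: subst_Var)
qed

text \<open>All variables that occur in an expression, free or bound.\<close>

fun vars_tm :: "('r, 'f, 'c) tm \<Rightarrow> nat set"
  and vars_fm :: "('r, 'f, 'c) fm \<Rightarrow> nat set" where
  "vars_tm (Var i) = {i}"
| "vars_tm (Cst c) = {}"
| "vars_tm (Fn g ts) = (\<Union>t\<in>set ts. vars_tm t)"
| "vars_tm (Epsilon i \<phi>) = insert i (vars_fm \<phi>)"
| "vars_fm (Rel r ts) = (\<Union>t\<in>set ts. vars_tm t)"
| "vars_fm (Eq s t) = vars_tm s \<union> vars_tm t"
| "vars_fm (Neg \<phi>) = vars_fm \<phi>"
| "vars_fm (Or \<phi> \<psi>) = vars_fm \<phi> \<union> vars_fm \<psi>"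

lemma finite_vars:
  fixes t :: "('r, 'f, 'c) tm" and \<phi> :: "('r, 'f, 'c) fm"
  shows "finite (vars_tm t)" and "finite (vars_fm \<phi>)"
  by (induction t and \<phi> rule: vars_tm_vars_fm.induct) auto

lemma subst_Epsilon_no_capture:
  assumes "\<And>j. j \<in> fv_fm \<phi> - {i} \<Longrightarrow> i \<notin> fv_tm (\<sigma> j)"
  shows "subst_tm \<sigma> (Epsilon i \<phi>) = Epsilon i (subst_fm (\<sigma>(i := Var i)) \<phi>)"
  using assms by (auto simp: bound_var_def)

text \<open>Composing substitutions is exact, not merely up to renaming, when neither of them renames:
  the first inserts no variable that already occurs (beyond leaving a variable in place), and the
  second replaces variables by closed terms or by themselves.\<close>

lemma subst_subst:
  fixes t :: "('r, 'f, 'c) tm" and \<phi> :: "('r, 'f, 'c) fm"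
  assumes "\<And>j. \<tau> j = Var j \<or> fv_tm (\<tau> j) = {}"
  shows "(\<And>j. fv_tm (\<sigma> j) \<inter> vars_tm t \<subseteq> {j}) \<Longrightarrow>
      subst_tm \<tau> (subst_tm \<sigma> t) = subst_tm (\<lambda>j. subst_tm \<tau> (\<sigma> j)) t"
    and "(\<And>j. fv_tm (\<sigma> j) \<inter> vars_fm \<phi> \<subseteq> {j}) \<Longrightarrow>
      subst_fm \<tau> (subst_fm \<sigma> \<phi>) = subst_fm (\<lambda>j. subst_tm \<tau> (\<sigma> j)) \<phi>"
  using assms
proof (induction t and \<phi> arbitrary: \<sigma> \<tau> and \<sigma> \<tau> rule: vars_tm_vars_fm.induct)
  case (3 g ts)
  have "subst_tm \<tau> (subst_tm \<sigma> t) = subst_tm (\<lambda>j. subst_tm \<tau> (\<sigma> j)) t" if "t \<in> set ts" for t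
    by (rule 3(1)[OF that _ 3(3)]) (use 3(2) that in fastforce)
  then show ?case by simp
next
  case (4 i \<phi>)
  have i: "i \<notin> fv_tm (\<sigma> j)" if "j \<noteq> i" for j using 4(2)[of j] that by auto
  have j: "i \<notin> fv_tm (\<tau> j)" if "j \<noteq> i" for j using 4(3)[of j] that by fastforce
  have k: "i \<notin> fv_tm (subst_tm \<tau> (\<sigma> j))" if "j \<noteq> i" for j
    using fv_subst(1)[of \<tau> "\<sigma> j"] i[OF that] j by fastforce
  have "subst_tm \<tau> (subst_tm \<sigma> (Epsilon i \<phi>)) =
      Epsilon i (subst_fm (\<tau>(i := Var i)) (subst_fm (\<sigma>(i := Var i)) \<phi>))"
    using i j by (subst subst_Epsilon_no_capture, fastforce)+ auto
  also have "subst_fm (\<tau>(i := Var i)) (subst_fm (\<sigma>(i := Var i)) \<phi>) =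
      subst_fm (\<lambda>j. subst_tm (\<tau>(i := Var i)) ((\<sigma>(i := Var i)) j)) \<phi>"
    by (rule 4(1)) (use 4(2-) in \<open>auto split: if_splits\<close>)
  also have "(\<lambda>j. subst_tm (\<tau>(i := Var i)) ((\<sigma>(i := Var i)) j)) =
      (\<lambda>j. subst_tm \<tau> (\<sigma> j))(i := Var i)"
    using i by (fastforce simp: fun_eq_iff intro!: subst_cong(1))
  also have "Epsilon i (subst_fm \<dots> \<phi>) = subst_tm (\<lambda>j. subst_tm \<tau> (\<sigma> j)) (Epsilon i \<phi>)"
    using k by (subst subst_Epsilon_no_capture) auto
  finally show ?case .
next
  case (5 r ts)
  have "subst_tm \<tau> (subst_tm \<sigma> t) = subst_tm (\<lambda>j. subst_tm \<tau> (\<sigma> j)) t" if "t \<in> set ts" for t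
    by (rule 5(1)[OF that _ 5(3)]) (use 5(2) that in fastforce)
  then show ?case by simp
next
  case (6 s t)
  have "subst_tm \<tau> (subst_tm \<sigma> s) = subst_tm (\<lambda>j. subst_tm \<tau> (\<sigma> j)) s"
    by (rule 6(1)) (use 6(3-) in auto)
  moreover have "subst_tm \<tau> (subst_tm \<sigma> t) = subst_tm (\<lambda>j. subst_tm \<tau> (\<sigma> j)) t"
    by (rule 6(2)) (use 6(3-) in auto)
  ultimately show ?case by simp
next
  case (8 \<phi> \<psi>)
  have "subst_fm \<tau> (subst_fm \<sigma> \<phi>) = subst_fm (\<lambda>j. subst_tm \<tau> (\<sigma> j)) \<phi>"
    by (rule 8(1)) (use 8(3-) in auto)
  moreover have "subst_fm \<tau> (subst_fm \<sigma> \<psi>) = subst_fm (\<lambda>j. subst_tm \<tau> (\<sigma> j)) \<psi>"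
    by (rule 8(2)) (use 8(3-) in auto)
  ultimately show ?case by simp
qed auto

lemma subst1_subst_closed:
  assumes a: "\<And>j. fv_tm (a j) = {}" and t: "fv_tm t = {}"
  shows "subst1 (subst_fm (a(i := Var i)) \<phi>) t i = subst_fm (a(i := t)) \<phi>"
proof -
  have "subst1 (subst_fm (a(i := Var i)) \<phi>) t i =
      subst_fm (\<lambda>j. subst_tm (Var(i := t)) ((a(i := Var i)) j)) \<phi>"
    unfolding subst1_def by (rule subst_subst(2)) (use a t in auto)
  also have "(\<lambda>j. subst_tm (Var(i := t)) ((a(i := Var i)) j)) = a(i := t)"
    using a by (auto simp: fun_eq_iff intro!: subst_closed)
  finally show ?thesis .
qed

lemma subst1_rename_fresh:
  assumes "fv_fm \<phi> \<subseteq> {i}" "k \<notin> vars_fm \<phi>" "fv_tm t = {}"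
  shows "subst1 (subst1 \<phi> (Var k) i) t k = subst1 \<phi> t i"
proof -
  have "subst1 (subst1 \<phi> (Var k) i) t k =
      subst_fm (\<lambda>j. subst_tm (Var(k := t)) ((Var(i := Var k)) j)) \<phi>"
    unfolding subst1_def by (rule subst_subst(2)) (use assms in auto)
  also have "\<dots> = subst1 \<phi> t i"
    unfolding subst1_def by (rule subst_cong(2)) (use assms(1) in auto)
  finally show ?thesis .
qed

lemma Fm1_rename: "\<phi> \<in> Fm1 L i \<Longrightarrow> subst1 \<phi> (Var k) i \<in> Fm1 L k"
  using fv_subst1[of \<phi> "Var k" i] subst1_Fm[of \<phi> L "Var k" i]
  by (auto simp: Fm1_def Tm_def)

section \<open>Derivations\<close>

lemma Fm_simps [simp]:
  "Neg \<phi> \<in> Fm L \<longleftrightarrow> \<phi> \<in> Fm L"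
  "Or \<phi> \<psi> \<in> Fm L \<longleftrightarrow> \<phi> \<in> Fm L \<and> \<psi> \<in> Fm L"
  "Imp \<phi> \<psi> \<in> Fm L \<longleftrightarrow> \<phi> \<in> Fm L \<and> \<psi> \<in> Fm L"
  "Iff \<phi> \<psi> \<in> Fm L \<longleftrightarrow> \<phi> \<in> Fm L \<and> \<psi> \<in> Fm L"
  "Eq s t \<in> Fm L \<longleftrightarrow> s \<in> Tm L \<and> t \<in> Tm L"
  by (auto simp: Fm_def Tm_def Imp_def Iff_def)

lemma Tm_simps [simp]:
  "Var i \<in> Tm L"
  "Epsilon i \<phi> \<in> Tm L \<longleftrightarrow> \<phi> \<in> Fm L"
  by (auto simp: Fm_def Tm_def)

lemma prov_taut1:
  "prov L \<Gamma> \<phi> \<Longrightarrow> \<phi> \<in> Fm L \<Longrightarrow> \<psi> \<in> Fm L \<Longrightarrow> tautology (Imp \<phi> \<psi>) \<Longrightarrow> prov L \<Gamma> \<psi>"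
  using mp taut by (metis Fm_simps(3))

lemma prov_taut2:
  assumes "prov L \<Gamma> \<phi>" "prov L \<Gamma> \<psi>" "\<phi> \<in> Fm L" "\<psi> \<in> Fm L" "\<chi> \<in> Fm L"
    "tautology (Imp \<phi> (Imp \<psi> \<chi>))"
  shows "prov L \<Gamma> \<chi>"
  using assms mp taut by (metis Fm_simps(3))

lemmas taut_simps = tautology_def Imp_def Iff_def

lemma prov_sym:
  assumes "s \<in> Tm L" "t \<in> Tm L" "prov L \<Gamma> (Eq s t)"
  shows "prov L \<Gamma> (Eq t s)"
proof -
  obtain w where w: "w \<notin> fv_tm s" using finite_fv(1) ex_new_if_finite infinite_UNIV_nat by blast
  note s = subst_tm_not_free[OF w]
  have "prov L \<Gamma> (subst1 (Eq (Var w) s) t w)"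
    by (rule prov_rewrite[OF assms(1,2) _ assms(3)])
       (use assms s in \<open>auto simp: subst1_def intro: eq_refl\<close>)
  then show ?thesis by (simp add: subst1_def s)
qed

lemma prov_trans:
  assumes "s \<in> Tm L" "t \<in> Tm L" "u \<in> Tm L" "prov L \<Gamma> (Eq s t)" "prov L \<Gamma> (Eq t u)"
  shows "prov L \<Gamma> (Eq s u)"
proof -
  obtain w where w: "w \<notin> fv_tm s" using finite_fv(1) ex_new_if_finite infinite_UNIV_nat by blast
  note s = subst_tm_not_free[OF w]
  have "prov L \<Gamma> (subst1 (Eq s (Var w)) u w)"
    by (rule prov_rewrite[OF assms(2,3) _ assms(5)]) (use assms s in \<open>auto simp: subst1_def\<close>)
  then show ?thesis by (simp add: subst1_def s)
qed

text \<open>Replacement of equals in an argument list.  The terms are closed but need not be epsilon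
  terms.\<close>

lemma prov_args_cong:
  assumes wf: "\<And>ts. length ts = n \<Longrightarrow> set ts \<subseteq> Tm L \<Longrightarrow> F ts \<in> Fm L"
    and sb: "\<And>\<sigma> ts. subst_fm \<sigma> (F ts) = F (map (subst_tm \<sigma>) ts)"
    and "list_all2 (\<lambda>s t. s \<in> Tm L \<and> t \<in> Tm L \<and> fv_tm s = {} \<and> fv_tm t = {} \<and>
          prov L \<Gamma> (Eq s t)) as bs"
    and "length as = n" "prov L \<Gamma> (F as)"
  shows "prov L \<Gamma> (F bs)"
proof -
  have "prov L \<Gamma> (F (ps @ bs))"
    if "length (ps @ as) = n" "\<forall>p\<in>set ps. p \<in> Tm L \<and> fv_tm p = {}" "prov L \<Gamma> (F (ps @ as))" for ps
    using assms(3) that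
  proof (induction arbitrary: ps rule: list_all2_induct)
    case Nil
    then show ?case by simp
  next
    case (Cons a as b bs)
    have as: "u \<in> Tm L \<and> fv_tm u = {}" if "u \<in> set as" for u
      using Cons.hyps(2) that by (auto simp: list_all2_conv_all_nth in_set_conv_nth)
    have sub: "subst1 (F (ps @ Var 0 # as)) u 0 = F (ps @ u # as)" for u
      using as Cons.prems(2)
      by (auto simp: subst1_def sb subst_closed intro!: arg_cong[of _ _ F] map_idI)
    have "prov L \<Gamma> (subst1 (F (ps @ Var 0 # as)) b 0)"
      by (rule prov_rewrite[of a]) (use Cons.hyps(1) Cons.prems as in \<open>auto simp: sub intro!: wf\<close>)
    then have "prov L \<Gamma> (F ((ps @ [b]) @ as))" by (simp add: sub)
    then have "prov L \<Gamma> (F ((ps @ [b]) @ bs))"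
      by (rule Cons.IH[rotated 2]) (use Cons.hyps(1) Cons.prems in auto)
    then show ?case by simp
  qed
  from this[of "[]"] show ?thesis using assms(4,5) by simp
qed

section \<open>Change of the bound variable of a closed epsilon term\<close>

text \<open>The term \<open>t\<close> may contain \<open>v\<^sub>i\<close> and other free variables.\<close>

lemma Epsilon_vacuous_disjunct:
  assumes "\<phi> \<in> Fm L" "t \<in> Tm L"
  shows "prov L \<Gamma> (Eq (Epsilon i (Or \<phi> (Neg (Eq t t)))) (Epsilon i \<phi>))"
proof (rule mp[OF extensionality])
  let ?\<phi>' = "Or \<phi> (Neg (Eq t t))"
  let ?c = "Epsilon i (Neg (Iff ?\<phi>' \<phi>))"
  let ?t = "subst_tm (Var(i := ?c)) t"
  have c: "?c \<in> Tm L" using assms by simp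
  then have t: "?t \<in> Tm L" using assms by (auto simp: Tm_def intro!: wf_subst)
  have "prov L \<Gamma> (Iff (Or (subst1 \<phi> ?c i) (Neg (Eq ?t ?t))) (subst1 \<phi> ?c i))"
    by (rule prov_taut1[OF eq_refl[OF t]])
       (use subst1_Fm[OF assms(1) c] t in \<open>auto simp: taut_simps\<close>)
  then show "prov L \<Gamma> (Forall i (Iff ?\<phi>' \<phi>))"
    unfolding Forall_def subst1_simps by (simp add: subst1_def)
qed (use assms in auto)

text \<open>Terms with prescribed free variables exist even in the language without symbols, as epsilon
  terms over equations.\<close>

lemma ex_term_fv_lessThan: "\<exists>t\<in>Tm L. fv_tm t = {..<n}"
proof (induction n)
  case 0
  have "Epsilon 0 (Eq (Var 0) (Var 0)) \<in> Tm L" by simp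
  moreover have "fv_tm (Epsilon 0 (Eq (Var 0) (Var 0))) = {..<0}" by simp
  ultimately show ?case by blast
next
  case (Suc n)
  then obtain t where t: "t \<in> Tm L" "fv_tm t = {..<n}" by blast
  have "Epsilon (Suc n) (Eq (Var n) t) \<in> Tm L" using t by simp
  moreover have "fv_tm (Epsilon (Suc n) (Eq (Var n) t)) = {..<Suc n}"
    by (simp add: t(2) lessThan_Suc insert_Diff_if)
  ultimately show ?case by blast
qed

text \<open>The renaming is forced by substituting a suitable open term.  With \<open>v\<^sub>k\<close> fresh and \<open>i < k\<close>,
  let \<open>E\<close> be \<open>(\<epsilon>v\<^sub>i)(\<phi> \<or> v\<^sub>k \<noteq> v\<^sub>k) = (\<epsilon>v\<^sub>i)\<phi>\<close>.  Substituting a closed term for \<open>v\<^sub>k\<close> in \<open>E\<close> gives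
  a theorem, by extensionality, so transfinity for \<open>\<not> E\<close> makes every instance \<open>E[t/v\<^sub>k]\<close> provable.
  If the free variables of \<open>t\<close> are exactly those below \<open>k\<close>, then \<open>v\<^sub>i\<close> has to be renamed, the least
  variable available is \<open>v\<^sub>k\<close>, and \<open>E[t/v\<^sub>k]\<close> is \<open>(\<epsilon>v\<^sub>k)(\<phi>[v\<^sub>k/v\<^sub>i] \<or> t \<noteq> t) = (\<epsilon>v\<^sub>i)\<phi>\<close>.\<close>

lemma prov_alpha:
  assumes \<phi>: "\<phi> \<in> Fm1 L i" and k: "k \<notin> vars_fm \<phi>" and ik: "i < k"
  shows "prov L \<Gamma> (Eq (Epsilon i \<phi>) (Epsilon k (subst1 \<phi> (Var k) i)))"
proof -
  have \<phi>': "\<phi> \<in> Fm L" "fv_fm \<phi> \<subseteq> {i}" "k \<notin> fv_fm \<phi>"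
    using \<phi> ik by (auto simp: Fm1_def)
  obtain t where t: "t \<in> Tm L" "fv_tm t = {..<k}" using ex_term_fv_lessThan by blast
  let ?th = "\<lambda>u. Epsilon i (Or \<phi> (Neg (Eq u u)))"
  define E where "E = Eq (?th (Var k)) (Epsilon i \<phi>)"
  let ?c = "Epsilon k (Neg E)"
  let ?\<psi> = "subst1 \<phi> (Var k) i"
  have \<psi>: "?\<psi> \<in> Fm L" using Fm1_rename[OF \<phi>] by (simp add: Fm1_def)
  have E: "E \<in> Fm L" "fv_fm E \<subseteq> {k}" using \<phi>' by (auto simp: E_def)
  have c: "?c \<in> Tm L" "fv_tm ?c = {}" using E by auto
  have closed: "subst_tm \<sigma> (Epsilon i \<phi>) = Epsilon i \<phi>" for \<sigma>
    using \<phi>' by (intro subst_closed) auto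
  have "subst_fm (Var(k := ?c, i := Var i)) \<phi> = subst_fm Var \<phi>"
    by (rule subst_cong(2)) (use \<phi>' in auto)
  then have "subst_fm (Var(k := ?c, i := Var i)) \<phi> = \<phi>" by (simp only: subst_Var)
  then have "subst_tm (Var(k := ?c)) (?th (Var k)) = ?th ?c"
    using c ik by (subst subst_Epsilon_no_capture) (auto split: if_splits)
  then have Ec: "subst1 E ?c k = Eq (?th ?c) (Epsilon i \<phi>)"
    by (simp only: E_def subst1_def subst_fm.simps closed)
  have "(\<Union>j\<in>fv_fm (Or \<phi> (Neg (Eq (Var k) (Var k)))) - {i}. fv_tm ((Var(k := t)) j)) = {..<k}"
    using \<phi>' t ik by (auto split: if_splits)
  moreover have "bound_var i {..<k} = k"
    using ik by (auto simp: bound_var_def intro!: Least_equality)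
  moreover have "subst_fm (Var(k := t, i := Var k)) \<phi> = ?\<psi>"
    unfolding subst1_def by (rule subst_cong(2)) (use \<phi>' in auto)
  ultimately have "subst_tm (Var(k := t)) (?th (Var k)) = Epsilon k (Or ?\<psi> (Neg (Eq t t)))"
    using ik by (simp only: subst_tm.simps(4) Let_def) simp
  then have Et: "subst1 E t k = Eq (Epsilon k (Or ?\<psi> (Neg (Eq t t)))) (Epsilon i \<phi>)"
    by (simp only: E_def subst1_def subst_fm.simps closed)
  have "prov L \<Gamma> (subst1 E ?c k)"
    unfolding Ec using Epsilon_vacuous_disjunct[OF \<phi>'(1) c(1)] .
  moreover have "prov L \<Gamma> (Imp (subst1 (Neg E) t k) (subst1 (Neg E) ?c k))"
    using t E by (intro transfinity) auto
  ultimately have "prov L \<Gamma> (subst1 E t k)"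
    by (rule prov_taut2) (use E t c in \<open>auto simp: taut_simps intro!: subst1_Fm\<close>)
  then have "prov L \<Gamma> (Eq (Epsilon i \<phi>) (Epsilon k (Or ?\<psi> (Neg (Eq t t)))))"
    unfolding Et by (rule prov_sym[rotated 2]) (use \<phi>' \<psi> t in auto)
  then show ?thesis
    by (rule prov_trans[rotated 3]) (use Epsilon_vacuous_disjunct[OF \<psi> t(1)] \<phi>' \<psi> t in auto)
qed

section \<open>Definable sets determine their epsilon terms\<close>

lemma Epsilon_Eps1: "\<phi> \<in> Fm1 L i \<Longrightarrow> Epsilon i \<phi> \<in> Eps1 L"
  by (auto simp: Eps1_def)

lemma ex_Eps1: "\<exists>t. t \<in> Eps1 L"
proof -
  have "Eq (Var 0) (Var 0) \<in> Fm1 L 0" by (simp add: Fm1_def)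
  then show ?thesis using Epsilon_Eps1 by blast
qed

lemma univ_eq: "univ (term_struct L \<Gamma>) = cls L \<Gamma> ` Eps1 L"
  by (auto simp: term_struct_def quotient_def cls_def)

lemma cls_in_def_set:
  assumes "\<phi> \<in> Fm1 L i" "t \<in> Eps1 L"
  shows "cls L \<Gamma> t \<in> def_set L \<Gamma> i \<phi> \<longleftrightarrow> prov L \<Gamma> (subst1 \<phi> t i)"
proof
  assume "cls L \<Gamma> t \<in> def_set L \<Gamma> i \<phi>"
  then obtain s where s: "s \<in> Eps1 L" "prov L \<Gamma> (subst1 \<phi> s i)" "cls L \<Gamma> t = cls L \<Gamma> s"
    by (auto simp: def_set_def)
  then have "prov L \<Gamma> (Eq s t)" using cls_eq_iff assms(2) by metis
  then show "prov L \<Gamma> (subst1 \<phi> t i)"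
    by (rule prov_rewrite[rotated 3]) (use s assms Eps1_closed in \<open>auto simp: Fm1_def\<close>)
qed (use assms in \<open>auto simp: def_set_def\<close>)

lemma Epsilon_in_def_set:
  assumes "\<phi> \<in> Fm1 L i" "def_set L \<Gamma> i \<phi> \<noteq> {}"
  shows "cls L \<Gamma> (Epsilon i \<phi>) \<in> def_set L \<Gamma> i \<phi>"
proof -
  obtain t where "t \<in> Eps1 L" "prov L \<Gamma> (subst1 \<phi> t i)"
    using assms(2) by (auto simp: def_set_def)
  then have "prov L \<Gamma> (subst1 \<phi> (Epsilon i \<phi>) i)"
    using assms(1) Eps1_closed mp[OF transfinity] by (fastforce simp: Fm1_def)
  then show ?thesis using assms(1) Epsilon_Eps1 cls_in_def_set by blast
qed

text \<open>Only the counterexample term \<open>(\<epsilon>v\<^sub>i)\<not>(\<phi> \<leftrightarrow> \<psi>)\<close> has to be tested, and the theory decides the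
  two sentences that it gives.\<close>

lemma def_set_eq_imp_Epsilon_eq:
  assumes cp: "complete_set L \<Gamma>" and \<phi>: "\<phi> \<in> Fm1 L i" and \<psi>: "\<psi> \<in> Fm1 L i"
    and eq: "def_set L \<Gamma> i \<phi> = def_set L \<Gamma> i \<psi>"
  shows "prov L \<Gamma> (Eq (Epsilon i \<phi>) (Epsilon i \<psi>))"
proof (rule mp[OF extensionality])
  let ?c = "Epsilon i (Neg (Iff \<phi> \<psi>))"
  let ?A = "subst1 \<phi> ?c i" and ?B = "subst1 \<psi> ?c i"
  have "Neg (Iff \<phi> \<psi>) \<in> Fm1 L i" using \<phi> \<psi> by (auto simp: Fm1_def Iff_def Imp_def)
  then have c: "?c \<in> Eps1 L" by (rule Epsilon_Eps1)
  have S: "?A \<in> Sent L" "?B \<in> Sent L" using subst1_Sent \<phi> \<psi> c by auto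
  then have F: "?A \<in> Fm L" "?B \<in> Fm L" by (auto simp: Sent_def)
  have iff: "prov L \<Gamma> ?A \<longleftrightarrow> prov L \<Gamma> ?B"
    using cls_in_def_set[OF \<phi> c, of \<Gamma>] cls_in_def_set[OF \<psi> c, of \<Gamma>] eq by simp
  have "prov L \<Gamma> (Iff ?A ?B)"
  proof (cases "prov L \<Gamma> ?A")
    case True
    then have "prov L \<Gamma> ?A" "prov L \<Gamma> ?B" using iff by auto
    then show ?thesis by (rule prov_taut2) (use F in \<open>auto simp: taut_simps\<close>)
  next
    case False
    then have "prov L \<Gamma> (Neg ?A)" "prov L \<Gamma> (Neg ?B)"
      using iff cp S unfolding complete_set_def by blast+
    then show ?thesis by (rule prov_taut2) (use F in \<open>auto simp: taut_simps\<close>)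
  qed
  then show "prov L \<Gamma> (Forall i (Iff \<phi> \<psi>))" by (simp add: Forall_def)
qed (use \<phi> \<psi> in \<open>auto simp: Fm1_def\<close>)

lemma def_set_rename:
  assumes "\<phi> \<in> Fm1 L i" "k \<notin> vars_fm \<phi>"
  shows "def_set L \<Gamma> k (subst1 \<phi> (Var k) i) = def_set L \<Gamma> i \<phi>"
proof -
  have "subst1 (subst1 \<phi> (Var k) i) t k = subst1 \<phi> t i" if "t \<in> Eps1 L" for t
    using assms Eps1_closed[OF that] by (intro subst1_rename_fresh) (auto simp: Fm1_def)
  then show ?thesis unfolding def_set_def by (simp cong: conj_cong)
qed

lemma def_set_eq_imp_cls_eq:
  assumes cp: "complete_set L \<Gamma>" and \<phi>: "\<phi> \<in> Fm1 L i" and \<psi>: "\<psi> \<in> Fm1 L j"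
    and eq: "def_set L \<Gamma> i \<phi> = def_set L \<Gamma> j \<psi>"
  shows "cls L \<Gamma> (Epsilon i \<phi>) = cls L \<Gamma> (Epsilon j \<psi>)"
proof -
  have fin: "finite (vars_fm \<phi> \<union> vars_fm \<psi> \<union> {..max i j})" by (simp add: finite_vars)
  obtain k where k: "k \<notin> vars_fm \<phi> \<union> vars_fm \<psi> \<union> {..max i j}"
    using ex_new_if_finite[OF infinite_UNIV_nat fin] ..
  let ?\<phi> = "subst1 \<phi> (Var k) i" and ?\<psi> = "subst1 \<psi> (Var k) j"
  note R = Fm1_rename[OF \<phi>] Fm1_rename[OF \<psi>]
  have "def_set L \<Gamma> k ?\<phi> = def_set L \<Gamma> k ?\<psi>"
    using def_set_rename[OF \<phi>] def_set_rename[OF \<psi>] k eq by auto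
  from def_set_eq_imp_Epsilon_eq[OF cp R this]
  have "cls L \<Gamma> (Epsilon k ?\<phi>) = cls L \<Gamma> (Epsilon k ?\<psi>)"
    using cls_eq_iff[OF Epsilon_Eps1[OF R(1)] Epsilon_Eps1[OF R(2)]] by blast
  moreover have "cls L \<Gamma> (Epsilon i \<phi>) = cls L \<Gamma> (Epsilon k ?\<phi>)"
    using prov_alpha[OF \<phi>] k cls_eq_iff[OF Epsilon_Eps1[OF \<phi>] Epsilon_Eps1[OF R(1)]] by auto
  moreover have "cls L \<Gamma> (Epsilon j \<psi>) = cls L \<Gamma> (Epsilon k ?\<psi>)"
    using prov_alpha[OF \<psi>] k cls_eq_iff[OF Epsilon_Eps1[OF \<psi>] Epsilon_Eps1[OF R(2)]] by auto
  ultimately show ?thesis by simp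
qed

section \<open>The truth lemma\<close>

text \<open>The function sends every definable set to the class of the epsilon term of any formula that
  defines it; in particular the class does not depend on the formula.\<close>

definition selects_Epsilon :: "('r, 'f, 'c) sim_type \<Rightarrow> ('r, 'f, 'c) fm set \<Rightarrow>
    (('r, 'f, 'c) tm set set \<Rightarrow> ('r, 'f, 'c) tm set) \<Rightarrow> bool" where
  "selects_Epsilon L \<Gamma> f \<longleftrightarrow>
     (\<forall>i. \<forall>\<phi>\<in>Fm1 L i. f (def_set L \<Gamma> i \<phi>) = cls L \<Gamma> (Epsilon i \<phi>))"

lemma ex_choice_selects_Epsilon:
  assumes "complete_set L \<Gamma>"
  shows "\<exists>f. choice_function (univ (term_struct L \<Gamma>)) f \<and> selects_Epsilon L \<Gamma> f"
proof -
  let ?M = "univ (term_struct L \<Gamma>)"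
  define P where "P S x \<longleftrightarrow> (\<exists>i. \<exists>\<phi>\<in>Fm1 L i. S = def_set L \<Gamma> i \<phi> \<and> x = cls L \<Gamma> (Epsilon i \<phi>))"
    for S x
  define f where "f S = (if \<exists>x. P S x then SOME x. P S x
    else if S = {} then SOME x. x \<in> ?M else SOME x. x \<in> S)" for S
  have ne: "?M \<noteq> {}" using ex_Eps1 by (auto simp: univ_eq)
  have fP: "P S (f S)" if "\<exists>x. P S x" for S
    using someI_ex[OF that] that by (simp add: f_def)
  have "f S \<in> ?M \<and> (S \<noteq> {} \<longrightarrow> f S \<in> S)" if S: "S \<subseteq> ?M" for S
  proof (cases "\<exists>x. P S x")
    case True
    then obtain i \<phi> where "\<phi> \<in> Fm1 L i" "S = def_set L \<Gamma> i \<phi>" "f S = cls L \<Gamma> (Epsilon i \<phi>)"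
      using fP[of S] by (auto simp: P_def)
    then show ?thesis
      using Epsilon_in_def_set[of \<phi> L i \<Gamma>] Epsilon_Eps1[of \<phi> L i] by (simp add: univ_eq)
  next
    case False
    have "f S \<in> ?M" if "S = {}"
      using False that ne someI_ex[of "\<lambda>x. x \<in> ?M"] by (auto simp: f_def)
    moreover have "f S \<in> S" if "S \<noteq> {}"
      using False that someI_ex[of "\<lambda>x. x \<in> S"] by (auto simp: f_def)
    ultimately show ?thesis using S by blast
  qed
  moreover have "f (def_set L \<Gamma> i \<phi>) = cls L \<Gamma> (Epsilon i \<phi>)" if "\<phi> \<in> Fm1 L i" for i \<phi>
  proof -
    have "P (def_set L \<Gamma> i \<phi>) (cls L \<Gamma> (Epsilon i \<phi>))" using that unfolding P_def by blast
    then have "P (def_set L \<Gamma> i \<phi>) (f (def_set L \<Gamma> i \<phi>))" by (intro fP) blast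
    then obtain j \<psi> where "\<psi> \<in> Fm1 L j" "def_set L \<Gamma> i \<phi> = def_set L \<Gamma> j \<psi>"
        "f (def_set L \<Gamma> i \<phi>) = cls L \<Gamma> (Epsilon j \<psi>)"
      unfolding P_def by blast
    then show ?thesis using def_set_eq_imp_cls_eq[OF assms that] by metis
  qed
  ultimately have "choice_function ?M f \<and> selects_Epsilon L \<Gamma> f"
    by (simp add: choice_function_def selects_Epsilon_def)
  then show ?thesis by blast
qed

text \<open>Every closed term is provably equal to an element of \<open>Eps1 L\<close>, in the form used to interpret
  the function symbols and constants.\<close>

lemma closed_term_Eps1:
  assumes "t \<in> Tm L" "fv_tm t = {}"
  shows "Epsilon 0 (Eq (Var 0) t) \<in> Eps1 L" "prov L \<Gamma> (Eq (Epsilon 0 (Eq (Var 0) t)) t)"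
proof -
  show "Epsilon 0 (Eq (Var 0) t) \<in> Eps1 L"
    using assms by (intro Epsilon_Eps1) (auto simp: Fm1_def)
  have "prov L \<Gamma> (Imp (subst1 (Eq (Var 0) t) t 0)
      (subst1 (Eq (Var 0) t) (Epsilon 0 (Eq (Var 0) t)) 0))"
    using assms by (intro transfinity) auto
  then show "prov L \<Gamma> (Eq (Epsilon 0 (Eq (Var 0) t)) t)"
    using mp eq_refl[OF assms(1)] by (simp add: subst1_def subst_closed[OF assms(2)]) blast
qed

lemma subst_Tm_closed:
  assumes "\<forall>n. a n \<in> Eps1 L" "t \<in> Tm L"
  shows "subst_tm a t \<in> Tm L \<and> fv_tm (subst_tm a t) = {}"
  using assms Eps1_closed fv_subst(1)[of a t] by (fastforce simp: Tm_def intro!: wf_subst)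

lemma subst_Sent:
  assumes "\<forall>n. a n \<in> Eps1 L" "\<phi> \<in> Fm L"
  shows "subst_fm a \<phi> \<in> Sent L"
  using assms Eps1_closed fv_subst(2)[of a \<phi>]
  by (fastforce simp: Fm_def Tm_def Sent_def intro!: wf_subst)

lemma truth_lemma:
  fixes L :: "('r, 'f, 'c) sim_type" and t :: "('r, 'f, 'c) tm" and \<phi> :: "('r, 'f, 'c) fm"
  assumes cp: "complete_set L \<Gamma>" and cs: "consistent_set L \<Gamma>" and f: "selects_Epsilon L \<Gamma> f"
  shows "t \<in> Tm L \<Longrightarrow> \<forall>n. a n \<in> Eps1 L \<Longrightarrow>
      \<exists>s\<in>Eps1 L. eval_tm (term_struct L \<Gamma>) f (\<lambda>n. cls L \<Gamma> (a n)) t = cls L \<Gamma> s \<and>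
        prov L \<Gamma> (Eq s (subst_tm a t))"
    and "\<phi> \<in> Fm L \<Longrightarrow> \<forall>n. a n \<in> Eps1 L \<Longrightarrow>
      sat (term_struct L \<Gamma>) f (\<lambda>n. cls L \<Gamma> (a n)) \<phi> \<longleftrightarrow> prov L \<Gamma> (subst_fm a \<phi>)"
proof (induction t and \<phi> arbitrary: a and a rule: fv_tm_fv_fm.induct)
  case (1 i)
  then show ?case using eq_refl Eps1_closed by fastforce
next
  case (2 c)
  then show ?case using closed_term_Eps1[of "Cst c" L] by (auto simp: term_struct_def)
next
  case (3 g ts)
  let ?ev = "eval_tm (term_struct L \<Gamma>) f (\<lambda>n. cls L \<Gamma> (a n))"
  have g: "g \<in> funs L" "length ts = fun_ar L g" "\<And>t. t \<in> set ts \<Longrightarrow> t \<in> Tm L"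
    using 3(2) by (auto simp: Tm_def)
  have "\<exists>s. s \<in> Eps1 L \<and> ?ev t = cls L \<Gamma> s \<and> prov L \<Gamma> (Eq s (subst_tm a t))"
    if "t \<in> set ts" for t
    using 3(1)[OF that g(3)[OF that] 3(3)] by blast
  \<comment> \<open>\<open>h t\<close> is a representative of the value of the argument \<open>t\<close>.\<close>
  then obtain h where h: "\<And>t. t \<in> set ts \<Longrightarrow>
      h t \<in> Eps1 L \<and> ?ev t = cls L \<Gamma> (h t) \<and> prov L \<Gamma> (Eq (h t) (subst_tm a t))"
    by metis
  let ?ss = "map h ts" and ?us = "map (subst_tm a) ts"
  have hc: "h t \<in> Tm L \<and> fv_tm (h t) = {}" if "t \<in> set ts" for t
    using h[OF that] Eps1_closed by blast
  have ss: "?ss \<in> lists (Eps1 L)" using h by auto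
  have fn: "Fn g ?ss \<in> Tm L" "fv_tm (Fn g ?ss) = {}"
    using g(1,2) hc by (auto simp: Tm_def)
  let ?e = "Epsilon 0 (Eq (Var 0) (Fn g ?ss))"
  note e = closed_term_Eps1[OF fn]
  have ev: "map ?ev ts = map (cls L \<Gamma>) ?ss" using h by simp
  have "?ev (Fn g ts) = cls L \<Gamma> ?e"
    using term_struct_fun[OF g(1) ss, of \<Gamma>] g(2) unfolding eval_tm.simps ev by simp
  moreover have "prov L \<Gamma> (Eq ?e (Fn g ?us))"
  proof (rule prov_args_cong[where F = "\<lambda>ts. Eq ?e (Fn g ts)"])
    show "Eq ?e (Fn g us) \<in> Fm L" if "length us = fun_ar L g" "set us \<subseteq> Tm L" for us
      using that g(1) fn by (auto simp: Tm_def)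
    show "subst_fm \<sigma> (Eq ?e (Fn g us)) = Eq ?e (Fn g (map (subst_tm \<sigma>) us))" for \<sigma> us
      using fn by (simp only: subst_fm.simps subst_tm.simps(3)) (subst subst_closed, auto)
    show "list_all2 (\<lambda>s t. s \<in> Tm L \<and> t \<in> Tm L \<and> fv_tm s = {} \<and> fv_tm t = {} \<and>
          prov L \<Gamma> (Eq s t)) ?ss ?us"
      using h hc subst_Tm_closed[OF 3(3) g(3)]
      by (auto simp: list_all2_map1 list_all2_map2 intro!: list.rel_refl_strong)
    show "length ?ss = fun_ar L g" using g(2) by simp
    show "prov L \<Gamma> (Eq ?e (Fn g ?ss))" by (rule e(2))
  qed
  ultimately show ?case using e(1) by auto
next
  case (4 i \<phi>)
  let ?\<phi> = "subst_fm (a(i := Var i)) \<phi>"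
  have \<phi>: "\<phi> \<in> Fm L" using 4(2) by simp
  have a: "\<And>j. fv_tm (a j) = {}" using Eps1_closed 4(3) by blast
  have sub: "subst_tm a (Epsilon i \<phi>) = Epsilon i ?\<phi>"
    using a by (intro subst_Epsilon_no_capture) auto
  have "?\<phi> \<in> Fm L" "fv_fm ?\<phi> \<subseteq> {i}"
    using subst_Tm_closed[OF 4(3,2)] fv_subst(2)[of "a(i := Var i)" \<phi>] a
    unfolding sub by (auto split: if_splits)
  then have F: "?\<phi> \<in> Fm1 L i" by (simp add: Fm1_def)
  have "sat (term_struct L \<Gamma>) f ((\<lambda>n. cls L \<Gamma> (a n))(i := cls L \<Gamma> b)) \<phi> \<longleftrightarrow>
      prov L \<Gamma> (subst1 ?\<phi> b i)" if b: "b \<in> Eps1 L" for b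
  proof -
    have "(\<lambda>n. cls L \<Gamma> (a n))(i := cls L \<Gamma> b) = (\<lambda>n. cls L \<Gamma> ((a(i := b)) n))"
      by (simp add: fun_eq_iff)
    moreover have "sat (term_struct L \<Gamma>) f (\<lambda>n. cls L \<Gamma> ((a(i := b)) n)) \<phi> \<longleftrightarrow>
        prov L \<Gamma> (subst_fm (a(i := b)) \<phi>)"
      by (rule 4(1)[OF \<phi>]) (use 4(3) b in auto)
    moreover have "subst1 ?\<phi> b i = subst_fm (a(i := b)) \<phi>"
      using Eps1_closed[OF b] by (simp add: subst1_subst_closed a)
    ultimately show ?thesis by simp
  qed
  then have "{m \<in> univ (term_struct L \<Gamma>). sat (term_struct L \<Gamma>) f ((\<lambda>n. cls L \<Gamma> (a n))(i := m)) \<phi>}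
      = def_set L \<Gamma> i ?\<phi>"
    by (auto simp: univ_eq def_set_def)
  then have "eval_tm (term_struct L \<Gamma>) f (\<lambda>n. cls L \<Gamma> (a n)) (Epsilon i \<phi>) = cls L \<Gamma> (Epsilon i ?\<phi>)"
    using f F by (simp add: selects_Epsilon_def)
  moreover have "Epsilon i ?\<phi> \<in> Eps1 L" using Epsilon_Eps1 F by blast
  ultimately show ?case unfolding sub using eq_refl Eps1_closed by blast
next
  case (5 r ts)
  let ?ev = "eval_tm (term_struct L \<Gamma>) f (\<lambda>n. cls L \<Gamma> (a n))"
  have r: "r \<in> rels L" "length ts = rel_ar L r" "\<And>t. t \<in> set ts \<Longrightarrow> t \<in> Tm L"
    using 5(2) by (auto simp: Fm_def Tm_def)
  have "\<exists>s. s \<in> Eps1 L \<and> ?ev t = cls L \<Gamma> s \<and> prov L \<Gamma> (Eq s (subst_tm a t))"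
    if "t \<in> set ts" for t
    using 5(1)[OF that r(3)[OF that] 5(3)] by blast
  \<comment> \<open>\<open>h t\<close> is a representative of the value of the argument \<open>t\<close>.\<close>
  then obtain h where h: "\<And>t. t \<in> set ts \<Longrightarrow>
      h t \<in> Eps1 L \<and> ?ev t = cls L \<Gamma> (h t) \<and> prov L \<Gamma> (Eq (h t) (subst_tm a t))"
    by metis
  let ?ss = "map h ts" and ?us = "map (subst_tm a) ts"
  have hc: "h t \<in> Tm L \<and> fv_tm (h t) = {}" if "t \<in> set ts" for t
    using h[OF that] Eps1_closed by blast
  have ss: "?ss \<in> lists (Eps1 L)" using h by auto
  have ev: "map ?ev ts = map (cls L \<Gamma>) ?ss" using h by simp
  have wf: "Rel r us \<in> Fm L" if "length us = rel_ar L r" "set us \<subseteq> Tm L" for us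
    using that r(1) by (auto simp: Fm_def Tm_def)
  have su: "list_all2 (\<lambda>s t. s \<in> Tm L \<and> t \<in> Tm L \<and> fv_tm s = {} \<and> fv_tm t = {} \<and>
          prov L \<Gamma> (Eq s t)) ?ss ?us"
    using h hc subst_Tm_closed[OF 5(3) r(3)]
    by (auto simp: list_all2_map1 list_all2_map2 intro!: list.rel_refl_strong)
  have "prov L \<Gamma> (Eq (subst_tm a t) (h t))" if "t \<in> set ts" for t
    using h[OF that] hc[OF that] subst_Tm_closed[OF 5(3) r(3)[OF that]] prov_sym by blast
  then have us: "list_all2 (\<lambda>s t. s \<in> Tm L \<and> t \<in> Tm L \<and> fv_tm s = {} \<and> fv_tm t = {} \<and>
          prov L \<Gamma> (Eq s t)) ?us ?ss"
    using hc subst_Tm_closed[OF 5(3) r(3)]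
    by (auto simp: list_all2_map1 list_all2_map2 intro!: list.rel_refl_strong)
  have "prov L \<Gamma> (Rel r ?ss) \<longleftrightarrow> prov L \<Gamma> (Rel r ?us)"
    using prov_args_cong[of "rel_ar L r" L "Rel r", OF wf _ su]
      prov_args_cong[of "rel_ar L r" L "Rel r", OF wf _ us] r(2) by auto
  then show ?case
    using term_struct_rel[OF r(1) ss, of \<Gamma>] r(2) unfolding sat.simps ev by (simp add: comp_def)
next
  case (6 s t)
  have st: "s \<in> Tm L" "t \<in> Tm L" using 6(3) by auto
  let ?ev = "eval_tm (term_struct L \<Gamma>) f (\<lambda>n. cls L \<Gamma> (a n))"
  obtain s' where s': "s' \<in> Eps1 L" "?ev s = cls L \<Gamma> s'" "prov L \<Gamma> (Eq s' (subst_tm a s))"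
    using 6(1)[OF st(1) 6(4)] by blast
  obtain t' where t': "t' \<in> Eps1 L" "?ev t = cls L \<Gamma> t'" "prov L \<Gamma> (Eq t' (subst_tm a t))"
    using 6(2)[OF st(2) 6(4)] by blast
  have Tm: "s' \<in> Tm L" "t' \<in> Tm L" "subst_tm a s \<in> Tm L" "subst_tm a t \<in> Tm L"
    using s' t' Eps1_closed subst_Tm_closed[OF 6(4)] st by auto
  have "prov L \<Gamma> (Eq s' t') \<longleftrightarrow> prov L \<Gamma> (Eq (subst_tm a s) (subst_tm a t))"
    using Tm s'(3) t'(3) prov_sym prov_trans by metis
  then show ?case using s'(2) t'(2) cls_eq_iff[OF s'(1) t'(1), of \<Gamma>] by simp
next
  case (7 \<phi>)
  have "\<phi> \<in> Fm L" using 7(2) by simp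
  then have "sat (term_struct L \<Gamma>) f (\<lambda>n. cls L \<Gamma> (a n)) \<phi> \<longleftrightarrow> prov L \<Gamma> (subst_fm a \<phi>)"
    "subst_fm a \<phi> \<in> Sent L" using 7(1,3) subst_Sent by auto
  then show ?case using cp cs by (auto simp: complete_set_def consistent_set_def Sent_def)
next
  case (8 \<phi> \<psi>)
  let ?A = "subst_fm a \<phi>" and ?B = "subst_fm a \<psi>"
  have \<phi>: "\<phi> \<in> Fm L" "\<psi> \<in> Fm L" using 8(3) by auto
  have S: "?A \<in> Sent L" "?B \<in> Sent L" using \<phi> 8(4) subst_Sent by auto
  then have F: "?A \<in> Fm L" "?B \<in> Fm L" by (auto simp: Sent_def)
  have "prov L \<Gamma> (Or ?A ?B)" if "prov L \<Gamma> ?A"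
    by (rule prov_taut1[OF that]) (use F in \<open>auto simp: taut_simps\<close>)
  moreover have "prov L \<Gamma> (Or ?A ?B)" if "prov L \<Gamma> ?B"
    by (rule prov_taut1[OF that]) (use F in \<open>auto simp: taut_simps\<close>)
  moreover have "prov L \<Gamma> ?B" if "prov L \<Gamma> (Or ?A ?B)" "\<not> prov L \<Gamma> ?A"
  proof -
    have "prov L \<Gamma> (Neg ?A)" using that(2) cp S by (auto simp: complete_set_def)
    with that(1) show ?thesis by (rule prov_taut2) (use F in \<open>auto simp: taut_simps\<close>)
  qed
  ultimately show ?case using 8(1)[OF \<phi>(1) 8(4)] 8(2)[OF \<phi>(2) 8(4)] by auto
qed

lemma truth_choice_of_selects_Epsilon:
  fixes L :: "('r, 'f, 'c) sim_type"
  assumes "complete_set L \<Gamma>" "consistent_set L \<Gamma>"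
    "choice_function (univ (term_struct L \<Gamma>)) f" "selects_Epsilon L \<Gamma> f"
  shows "truth_choice L \<Gamma> f"
proof -
  have "eval_tm (term_struct L \<Gamma>) f (\<lambda>n. cls L \<Gamma> (a n)) t \<in> univ (term_struct L \<Gamma>) \<and>
      (\<forall>s\<in>eval_tm (term_struct L \<Gamma>) f (\<lambda>n. cls L \<Gamma> (a n)) t. prov L \<Gamma> (Eq s (subst_tm a t)))"
    if a: "\<forall>n. a n \<in> Eps1 L" and t: "t \<in> Tm L" for a :: "nat \<Rightarrow> ('r, 'f, 'c) tm" and t
  proof -
    obtain s where s: "s \<in> Eps1 L" "prov L \<Gamma> (Eq s (subst_tm a t))"
      "eval_tm (term_struct L \<Gamma>) f (\<lambda>n. cls L \<Gamma> (a n)) t = cls L \<Gamma> s"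
      using truth_lemma(1)[OF assms(1,2,4) t a] by blast
    have "prov L \<Gamma> (Eq u (subst_tm a t))" if "u \<in> cls L \<Gamma> s" for u
    proof -
      have u: "u \<in> Eps1 L" "prov L \<Gamma> (Eq s u)" using that by (auto simp: cls_def prov_eq_def)
      then have "prov L \<Gamma> (Eq u s)" using s(1) prov_eq_sym by blast
      then show ?thesis
        by (rule prov_trans[rotated 3]) (use s u Eps1_closed subst_Tm_closed[OF a t] in auto)
    qed
    then show ?thesis using s by (simp add: univ_eq)
  qed
  then show ?thesis
    using assms(3) truth_lemma(2)[OF assms(1,2,4)] unfolding truth_choice_def by blast
qed

text \<open>The values on definable sets are forced: by the truth condition the set that \<open>\<phi>\<close> defines in
  the structure is \<open>def_set L \<Gamma> i \<phi>\<close>, and the value of \<open>(\<epsilon>v\<^sub>i)\<phi>\<close> is the class of this term.\<close>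

lemma selects_Epsilon_of_truth_choice:
  assumes g: "truth_choice L \<Gamma> g"
  shows "selects_Epsilon L \<Gamma> g"
  unfolding selects_Epsilon_def
proof (intro allI ballI)
  fix i \<phi> assume \<phi>: "\<phi> \<in> Fm1 L i"
  then have F: "\<phi> \<in> Fm L" "fv_fm \<phi> \<subseteq> {i}" by (auto simp: Fm1_def)
  have tr: "(\<forall>\<phi>\<in>Fm L. sat (term_struct L \<Gamma>) g (\<lambda>n. cls L \<Gamma> (a n)) \<phi> \<longleftrightarrow>
        prov L \<Gamma> (subst_fm a \<phi>)) \<and>
      (\<forall>t\<in>Tm L. eval_tm (term_struct L \<Gamma>) g (\<lambda>n. cls L \<Gamma> (a n)) t \<in> univ (term_struct L \<Gamma>) \<and>
        (\<forall>s\<in>eval_tm (term_struct L \<Gamma>) g (\<lambda>n. cls L \<Gamma> (a n)) t.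
          prov L \<Gamma> (Eq s (subst_tm a t))))"
    if "\<forall>n. a n \<in> Eps1 L" for a
    using g that unfolding truth_choice_def by blast
  obtain e where e: "e \<in> Eps1 L" using ex_Eps1 by blast
  let ?a = "\<lambda>n. e"
  let ?ev = "eval_tm (term_struct L \<Gamma>) g (\<lambda>n. cls L \<Gamma> (?a n)) (Epsilon i \<phi>)"
  have "sat (term_struct L \<Gamma>) g ((\<lambda>n. cls L \<Gamma> e)(i := cls L \<Gamma> b)) \<phi> \<longleftrightarrow>
      prov L \<Gamma> (subst1 \<phi> b i)" if b: "b \<in> Eps1 L" for b
  proof -
    have "sat (term_struct L \<Gamma>) g (\<lambda>n. cls L \<Gamma> ((?a(i := b)) n)) \<phi> \<longleftrightarrow>
        prov L \<Gamma> (subst_fm (?a(i := b)) \<phi>)"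
      using tr[of "?a(i := b)"] e b F(1) by auto
    moreover have "(\<lambda>n. cls L \<Gamma> e)(i := cls L \<Gamma> b) = (\<lambda>n. cls L \<Gamma> ((?a(i := b)) n))"
      by (simp add: fun_eq_iff)
    moreover have "subst_fm (?a(i := b)) \<phi> = subst1 \<phi> b i"
      unfolding subst1_def by (rule subst_cong(2)) (use F in auto)
    ultimately show ?thesis by simp
  qed
  then have "{m \<in> univ (term_struct L \<Gamma>). sat (term_struct L \<Gamma>) g ((\<lambda>n. cls L \<Gamma> e)(i := m)) \<phi>}
      = def_set L \<Gamma> i \<phi>"
    by (auto simp: univ_eq def_set_def)
  then have ev: "?ev = g (def_set L \<Gamma> i \<phi>)" by simp
  have "Epsilon i \<phi> \<in> Tm L" using F by simp
  then have "?ev \<in> univ (term_struct L \<Gamma>)"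
    and val: "\<And>s. s \<in> ?ev \<Longrightarrow> prov L \<Gamma> (Eq s (subst_tm ?a (Epsilon i \<phi>)))"
    using tr[of ?a] e by blast+
  then obtain s where s: "s \<in> Eps1 L" "?ev = cls L \<Gamma> s" by (auto simp: univ_eq)
  have "s \<in> ?ev"
    unfolding s(2) using s(1) eq_refl[of s L \<Gamma>] Eps1_closed[of s L]
    by (auto simp: cls_def prov_eq_def)
  moreover have "subst_tm ?a (Epsilon i \<phi>) = Epsilon i \<phi>"
    using F by (intro subst_closed) auto
  ultimately have "prov L \<Gamma> (Eq s (Epsilon i \<phi>))" using val by metis
  then have "cls L \<Gamma> s = cls L \<Gamma> (Epsilon i \<phi>)"
    using cls_eq_iff s(1) Epsilon_Eps1[OF \<phi>] by blast
  then show "g (def_set L \<Gamma> i \<phi>) = cls L \<Gamma> (Epsilon i \<phi>)" using ev s(2) by simp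
qed

theorem proposition1:
  fixes L :: "('r, 'f, 'c) sim_type" and \<Gamma> :: "('r, 'f, 'c) fm set"
  assumes "\<Gamma> \<subseteq> Sent L"
    and "complete_set L \<Gamma>"
    and "consistent_set L \<Gamma>"
  shows "(\<forall>i. \<forall>\<phi>\<in>Fm1 L i. \<forall>\<psi>\<in>Fm1 L i.
            def_set L \<Gamma> i \<phi> = def_set L \<Gamma> i \<psi> \<longrightarrow> cls L \<Gamma> (Epsilon i \<phi>) = cls L \<Gamma> (Epsilon i \<psi>))
       \<and> (\<exists>f. truth_choice L \<Gamma> f \<and>
            (\<forall>g. truth_choice L \<Gamma> g \<longrightarrow>
               (\<forall>S \<in> {def_set L \<Gamma> i \<phi> | i \<phi>. \<phi> \<in> Fm1 L i}. g S = f S)))"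
proof (intro conjI)
  show "\<forall>i. \<forall>\<phi>\<in>Fm1 L i. \<forall>\<psi>\<in>Fm1 L i.
      def_set L \<Gamma> i \<phi> = def_set L \<Gamma> i \<psi> \<longrightarrow> cls L \<Gamma> (Epsilon i \<phi>) = cls L \<Gamma> (Epsilon i \<psi>)"
    using def_set_eq_imp_cls_eq[OF assms(2)] by blast
  obtain f where f: "choice_function (univ (term_struct L \<Gamma>)) f" "selects_Epsilon L \<Gamma> f"
    using ex_choice_selects_Epsilon[OF assms(2)] by blast
  have "g S = f S" if "truth_choice L \<Gamma> g" "S \<in> {def_set L \<Gamma> i \<phi> | i \<phi>. \<phi> \<in> Fm1 L i}" for g S
    using selects_Epsilon_of_truth_choice[OF that(1)] that(2) f(2)
    by (auto simp: selects_Epsilon_def)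
  then show "\<exists>f. truth_choice L \<Gamma> f \<and> (\<forall>g. truth_choice L \<Gamma> g \<longrightarrow>
      (\<forall>S \<in> {def_set L \<Gamma> i \<phi> | i \<phi>. \<phi> \<in> Fm1 L i}. g S = f S))"
    using truth_choice_of_selects_Epsilon[OF assms(2,3) f] by blast
qed

end
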